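(* Let $\mathscr C$ be a function clone with domain $C$ which contains $\mathscr O^{(1)}_C$, the set of all unary functions $C\to C$. Then $\mathscr C$ has automatic continuity, i.e. every clone homomorphism from $\mathscr C$ into $\mathscr O_D$, where $D$ is a countably infinite set, is continuous.
   Context: For a set $D$, $\mathscr O_D$ denotes the set of all operations $D^n\to D$, $n\ge1$. A function clone with domain $D$ is a subset of $\mathscr O_D$ containing all projections $\pi^n_k(x_1,\dots,x_n)=x_k$ and closed under composition $f(g_1,\dots,g_n)$ ($f$ $n$-ary, all $g_i$ $m$-ary). $\mathscr O_D$ carries the topology of pointwise convergence: for each $n$ the set of $n$-ary operations is clopen, and a subbasis is given by the sets $\{f\colon D^n\to D \mid f(a_1,\dots,a_n)=a_0\}$; function clones carry the subspace topology. A clone homomorphism between function clones is a map preserving arities, sending each projection $\pi^n_k$ to the corresponding projection $\pi^n_k$, and satisfying $\xi(f(g_1,\dots,g_n))=\xi(f)(\xi(g_1),\dots,\xi(g_n))$. *)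

theory Defs
  imports "HOL-Analysis.Analysis" "HOL-Library.NList"
begin

text \<open>
  An \<open>n\<close>-ary operation on \<open>D\<close> is a pair \<open>(n, f)\<close>, where \<open>f\<close> is defined on the \<open>n\<close>-tuples
  (lists of length \<open>n\<close>) over \<open>D\<close> and is undefined elsewhere, so that equality of pairs is equality
  of operations with their arities, also over an empty domain. Coordinates are numbered from \<open>0\<close>.
\<close>

type_synonym 'a operation = "nat \<times> ('a list \<Rightarrow> 'a)"

definition nary_ops :: "'a set \<Rightarrow> nat \<Rightarrow> 'a operation set" where
  "nary_ops D n = {n} \<times> (nlists n D \<rightarrow>\<^sub>E D)"

definition all_ops :: "'a set \<Rightarrow> 'a operation set" where
  "all_ops D = (\<Union>n\<in>{1..}. nary_ops D n)"

definition proj_op :: "'a set \<Rightarrow> nat \<Rightarrow> nat \<Rightarrow> 'a operation" where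
  "proj_op D n k = (n, \<lambda>xs\<in>nlists n D. xs ! k)"

text \<open>The composition \<open>f(g\<^sub>1,\<dots>,g\<^sub>n)\<close>, where \<open>gs\<close> lists the \<open>m\<close>-ary operations \<open>g\<^sub>1,\<dots>,g\<^sub>n\<close>.\<close>

definition comp_op ::
  "'a set \<Rightarrow> nat \<Rightarrow> 'a operation \<Rightarrow> 'a operation list \<Rightarrow> 'a operation" where
  "comp_op D m f gs = (m, \<lambda>xs\<in>nlists m D. snd f (map (\<lambda>g. snd g xs) gs))"

definition function_clone :: "'a set \<Rightarrow> 'a operation set \<Rightarrow> bool" where
  "function_clone D \<C> \<longleftrightarrow>
     \<C> \<subseteq> all_ops D \<and>
     (\<forall>n\<ge>1. \<forall>k<n. proj_op D n k \<in> \<C>) \<and>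
     (\<forall>n\<ge>1. \<forall>m\<ge>1. \<forall>f \<in> \<C> \<inter> nary_ops D n. \<forall>gs \<in> nlists n (\<C> \<inter> nary_ops D m).
        comp_op D m f gs \<in> \<C>)"

definition clone_hom ::
  "'a set \<Rightarrow> 'a operation set \<Rightarrow> 'b set \<Rightarrow> 'b operation set \<Rightarrow>
   ('a operation \<Rightarrow> 'b operation) \<Rightarrow> bool" where
  "clone_hom C \<C> D \<D> \<xi> \<longleftrightarrow>
     \<xi> ` \<C> \<subseteq> \<D> \<and>
     (\<forall>f\<in>\<C>. fst (\<xi> f) = fst f) \<and>
     (\<forall>n\<ge>1. \<forall>k<n. \<xi> (proj_op C n k) = proj_op D n k) \<and>
     (\<forall>n\<ge>1. \<forall>m\<ge>1. \<forall>f \<in> \<C> \<inter> nary_ops C n. \<forall>gs \<in> nlists n (\<C> \<inter> nary_ops C m).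
        \<xi> (comp_op C m f gs) = comp_op D m (\<xi> f) (map \<xi> gs))"

text \<open>
  The topology of pointwise convergence. The sets of \<open>n\<close>-ary operations are included among the
  generators to make them clopen; this only matters if \<open>D\<close> is empty.
\<close>

definition pointwise_topology :: "'a set \<Rightarrow> 'a operation topology" where
  "pointwise_topology D = topology_generated_by
     ({nary_ops D n | n. n \<ge> 1} \<union>
      {{p \<in> nary_ops D n. snd p a = a0} | n a a0. n \<ge> 1 \<and> a \<in> nlists n D \<and> a0 \<in> D})"

definition clone_topology :: "'a set \<Rightarrow> 'a operation set \<Rightarrow> 'a operation topology" where
  "clone_topology D \<C> = subtopology (pointwise_topology D) \<C>"

lemma topspace_pointwise_topology: "topspace (pointwise_topology D) = all_ops D"
  unfolding pointwise_topology_def topology_generated_by_topspace all_ops_def by auto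

lemma openin_nary_ops: "n \<ge> 1 \<Longrightarrow> openin (pointwise_topology D) (nary_ops D n)"
  unfolding pointwise_topology_def by (rule topology_generated_by_Basis) auto

lemma openin_pointwise_eq:
  assumes "n \<ge> 1" "a \<in> nlists n D" "a0 \<in> D"
  shows "openin (pointwise_topology D) {p \<in> nary_ops D n. snd p a = a0}"
  unfolding pointwise_topology_def by (rule topology_generated_by_Basis) (use assms in blast)

lemma closedin_nary_ops:
  assumes "n \<ge> 1"
  shows "closedin (pointwise_topology D) (nary_ops D n)"
proof -
  have "all_ops D - nary_ops D n = (\<Union>m\<in>{1..} - {n}. nary_ops D m)"
    unfolding all_ops_def nary_ops_def by auto
  then have "openin (pointwise_topology D) (all_ops D - nary_ops D n)"
    by (auto intro: openin_nary_ops intro!: openin_Union)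
  moreover have "nary_ops D n \<subseteq> all_ops D"
    using assms unfolding all_ops_def by auto
  ultimately show ?thesis
    by (simp add: closedin_def topspace_pointwise_topology)
qed

lemma pointwise_topology_eq_sum_topology:
  "pointwise_topology D =
     sum_topology (\<lambda>n. product_topology (\<lambda>_. discrete_topology D) (nlists n D)) {1..}"
    (is "?T = ?S")
proof (rule topology_eq[THEN iffD2], intro allI iffI)
  fix U assume "openin ?T U"
  then have gen: "generate_topology_on
     ({nary_ops D n | n. n \<ge> 1} \<union>
      {{p \<in> nary_ops D n. snd p a = a0} | n a a0. n \<ge> 1 \<and> a \<in> nlists n D \<and> a0 \<in> D}) U"
    unfolding pointwise_topology_def openin_topology_generated_by_iff .
  have nary: "openin ?S (nary_ops D n)" if "n \<ge> 1" for n
  proof -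
    have "{x. (i, x) \<in> nary_ops D n} = (if i = n then nlists n D \<rightarrow>\<^sub>E D else {})" for i
      by (auto simp: nary_ops_def)
    moreover have "openin (product_topology (\<lambda>_. discrete_topology D) (nlists n D))
       (nlists n D \<rightarrow>\<^sub>E D)"
      using openin_topspace[of "product_topology (\<lambda>_. discrete_topology D) (nlists n D)"]
      by (simp add: topspace_product_topology)
    ultimately show ?thesis
      using that by (auto simp: openin_sum_topology nary_ops_def)
  qed
  have eq: "openin ?S {p \<in> nary_ops D n. snd p a = a0}"
    if "n \<ge> 1" "a \<in> nlists n D" "a0 \<in> D" for n a a0
  proof -
    let ?P = "product_topology (\<lambda>_. discrete_topology D) (nlists n D)"
    have slice: "{x. (i, x) \<in> {p \<in> nary_ops D n. snd p a = a0}} =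
        (if i = n then {f \<in> topspace ?P. f a \<in> {a0}} else {})" for i
      by (auto simp: nary_ops_def)
    have "continuous_map ?P (discrete_topology D) (\<lambda>f. f a)"
      using that by (intro continuous_map_product_projection)
    then have "openin ?P {f \<in> topspace ?P. f a \<in> {a0}}"
      by (rule openin_continuous_map_preimage) (use that in auto)
    moreover have "{p \<in> nary_ops D n. snd p a = a0} \<subseteq> Sigma {1..} (topspace \<circ>
        (\<lambda>n. product_topology (\<lambda>_. discrete_topology D) (nlists n D)))"
      using that by (auto simp: nary_ops_def)
    ultimately show ?thesis
      unfolding openin_sum_topology slice by (simp only: if_split openin_empty) simp
  qed
  show "openin ?S U"
    using gen by induction (use nary eq in auto)
next
  fix U assume U: "openin ?S U"
  have part: "openin ?T {p \<in> nary_ops D n. p \<in> U}" if n: "n \<ge> 1" for n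
  proof -
    let ?P = "product_topology (\<lambda>_. discrete_topology D) (nlists n D)"
    let ?N = "subtopology ?T (nary_ops D n)"
    have N: "topspace ?N = nary_ops D n"
      using n by (auto simp: topspace_pointwise_topology all_ops_def)
    have "continuous_map ?N (discrete_topology D) (\<lambda>p. snd p a)" if a: "a \<in> nlists n D" for a
    proof -
      have "openin ?T {p \<in> nary_ops D n. snd p a \<in> V}" if "V \<subseteq> D" for V
      proof -
        have "{p \<in> nary_ops D n. snd p a \<in> V} = (\<Union>v\<in>V. {p \<in> nary_ops D n. snd p a = v})"
          by auto
        moreover have "openin ?T (\<Union>v\<in>V. {p \<in> nary_ops D n. snd p a = v})"
          by (rule openin_Union) (use openin_pointwise_eq[OF n a] that in blast)
        ultimately show ?thesis
          by (simp only:)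
      qed
      then have "openin ?N {p \<in> nary_ops D n. snd p a \<in> V}" if "V \<subseteq> D" for V
        using that n by (auto simp: openin_open_subtopology openin_nary_ops)
      moreover have "snd p a \<in> D" if "p \<in> nary_ops D n" for p
        using that a by (auto simp: nary_ops_def)
      ultimately show ?thesis
        unfolding continuous_map_def N by auto
    qed
    then have "continuous_map ?N ?P snd"
      unfolding continuous_map_componentwise N by (auto simp: nary_ops_def PiE_def)
    moreover have "openin ?P {x. (n, x) \<in> U}"
      using U n by (auto simp: openin_sum_topology)
    ultimately have "openin ?N {p \<in> topspace ?N. snd p \<in> {x. (n, x) \<in> U}}"
      by (rule openin_continuous_map_preimage)
    then have "openin ?T {p \<in> topspace ?N. snd p \<in> {x. (n, x) \<in> U}}"
      using openin_trans_full openin_nary_ops[OF n] by blast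
    moreover have "{p \<in> topspace ?N. snd p \<in> {x. (n, x) \<in> U}} = {p \<in> nary_ops D n. p \<in> U}"
      unfolding N by (auto simp: nary_ops_def)
    ultimately show ?thesis
      by (simp only:)
  qed
  have "topspace ?S = all_ops D"
    by (auto simp: all_ops_def nary_ops_def)
  then have "U \<subseteq> all_ops D"
    using openin_subset[OF U] by simp
  then have U_eq: "(\<Union>n\<in>{1..}. {p \<in> nary_ops D n. p \<in> U}) = U"
    unfolding all_ops_def by blast
  have "openin ?T (\<Union>n\<in>{1..}. {p \<in> nary_ops D n. p \<in> U})"
  proof (rule openin_Union)
    fix K assume "K \<in> (\<lambda>n. {p \<in> nary_ops D n. p \<in> U}) ` {1..}"
    then obtain n where "n \<ge> 1" "K = {p \<in> nary_ops D n. p \<in> U}"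
      by blast
    then show "openin ?T K"
      using part by blast
  qed
  then show "openin ?T U"
    unfolding U_eq .
qed

lemma function_clone_all_ops: "function_clone D (all_ops D)"
proof -
  have proj: "proj_op D n k \<in> nary_ops D n" if "k < n" for n k
  proof -
    have "xs ! k \<in> D" if "xs \<in> nlists n D" for xs
      using that \<open>k < n\<close> by (rule nlistsE_nth_in)
    then show ?thesis
      by (simp add: nary_ops_def proj_op_def)
  qed
  have comp: "comp_op D m f gs \<in> nary_ops D m"
    if f: "f \<in> nary_ops D n" and len: "length gs = n" and gs: "set gs \<subseteq> nary_ops D m" for n m f gs
  proof -
    have "snd f (map (\<lambda>g. snd g xs) gs) \<in> D" if xs: "xs \<in> nlists m D" for xs
    proof -
      have "snd g xs \<in> D" if "g \<in> set gs" for g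
        using subsetD[OF gs that] xs by (auto simp: nary_ops_def)
      then have "map (\<lambda>g. snd g xs) gs \<in> nlists n D"
        by (intro nlistsI) (use len in auto)
      then show ?thesis
        using f by (auto simp: nary_ops_def)
    qed
    then show ?thesis
      by (simp add: nary_ops_def comp_op_def)
  qed
  have "nary_ops D n \<subseteq> all_ops D" if "n \<ge> 1" for n
    using that unfolding all_ops_def by blast
  then show ?thesis
    unfolding function_clone_def nlists_def using proj comp by blast
qed

end

theory Submission
  imports Defs
begin

text \<open>
  A clone homomorphism \<open>\<xi>\<close> turns every unary \<open>h\<close> on \<open>C\<close> into a transformation of \<open>D\<close>, so the
  monoid of all self-maps of \<open>C\<close> acts on \<open>D\<close>. The heart of the proof is that each \<open>d \<in> D\<close> is fixed
  by some self-map \<open>r\<close> of \<open>C\<close> with \<^emph>\<open>finite\<close> range (\<open>fixed_by_finite_range\<close>).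

  For finite \<open>C\<close> the identity is such a map. If \<open>C\<close> is infinite, there is an uncountable
  family of injections \<open>s: C \<rightarrow> C\<close> whose ranges meet pairwise in finite sets
  (\<open>uncountable_almost_disjoint_injections\<close>). As \<open>D\<close> is countable, two
  different members \<open>s\<close>, \<open>s'\<close> of the family send \<open>d\<close> to the same point. Let \<open>t\<close> be the left inverse
  of \<open>s\<close> that is constant outside the range of \<open>s\<close>. Then \<open>d = t(s(d)) = t(s'(d))\<close>, and \<open>t \<circ> s'\<close>
  has finite range because only finitely many values of \<open>s'\<close> lie in the range of \<open>s\<close>.

  Now let \<open>d\<^sub>1,\<dots>,d\<^sub>n \<in> D\<close> be fixed by \<open>r\<^sub>1,\<dots>,r\<^sub>n\<close> with finite ranges. For an \<open>n\<close>-ary \<open>f\<close> in the clone,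
  \<open>\<xi>(f)(d\<^sub>1,\<dots>,d\<^sub>n) = \<xi>(f)(\<xi>(r\<^sub>1)(d\<^sub>1),\<dots>,\<xi>(r\<^sub>n)(d\<^sub>n))\<close>, which is the value at \<open>(d\<^sub>1,\<dots>,d\<^sub>n)\<close> of the image
  of \<open>f(r\<^sub>1(x\<^sub>1),\<dots>,r\<^sub>n(x\<^sub>n))\<close>. The latter operation depends only on the restriction of \<open>f\<close> to the
  finite product of the ranges of the \<open>r\<^sub>j\<close> (\<open>finitely_determined\<close>). This is continuity.
\<close>

section \<open>Almost disjoint injections of an infinite set into itself\<close>

lemma uncountable_bool_sequences: "uncountable (UNIV :: (nat \<Rightarrow> bool) set)"
proof
  assume "countable (UNIV :: (nat \<Rightarrow> bool) set)"
  then obtain e :: "nat \<Rightarrow> nat \<Rightarrow> bool" where "range e = UNIV"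
    using uncountable_def by blast
  then obtain n where "e n = (\<lambda>k. \<not> e k k)"
    by (metis rangeE UNIV_I)
  then show False
    by (metis (full_types))
qed

text \<open>
  The branches of the infinite binary tree, viewed as sets of finite bit strings, form an
  uncountable family of pairwise almost disjoint sets. An injection is obtained for each branch by
  listing \<open>C\<close> and sending its \<open>n\<close>-th element to (a code for) the \<open>n\<close>-th node of the branch.
\<close>

lemma almost_disjoint_injections_countable:
  fixes C :: "'a set"
  assumes "countable C" "infinite C"
  obtains S :: "('a \<Rightarrow> 'a) set"
  where "uncountable S" "\<And>s. s \<in> S \<Longrightarrow> inj_on s C \<and> s ` C \<subseteq> C"
    "\<And>s s'. \<lbrakk>s \<in> S; s' \<in> S; s \<noteq> s'\<rbrakk> \<Longrightarrow> finite (s ` C \<inter> s' ` C)"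
proof -
  define code :: "bool list \<Rightarrow> 'a" where "code = from_nat_into C \<circ> to_nat"
  define node :: "(nat \<Rightarrow> bool) \<Rightarrow> nat \<Rightarrow> bool list" where "node x n = map x [0..<n]" for x n
  define s where "s x = (\<lambda>p. code (node x (to_nat_on C p)))" for x
  have index: "bij_betw (to_nat_on C) C UNIV"
    using assms by (rule to_nat_on_infinite)
  have "bij_betw (from_nat_into C) UNIV C"
    using assms by (rule bij_betw_from_nat_into)
  then have code: "inj code" "range code \<subseteq> C"
    unfolding code_def by (auto simp: bij_betw_def intro: inj_compose)
  have node_eq: "n = m \<and> (\<forall>k<n. x k = y k)" if "node x n = node y m" for x y n m
  proof -
    have "n = m"
      using arg_cong[OF that, of length] by (simp add: node_def)
    then show ?thesis
      using that by (auto simp: node_def)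
  qed
  have inj_s: "inj_on (s x) C" for x
  proof (rule inj_onI)
    fix p q assume pq: "p \<in> C" "q \<in> C" "s x p = s x q"
    then have "node x (to_nat_on C p) = node x (to_nat_on C q)"
      using injD[OF code(1)] by (simp add: s_def)
    then have "to_nat_on C p = to_nat_on C q"
      using node_eq by blast
    then show "p = q"
      using index pq(1,2) by (auto simp: bij_betw_def dest: inj_onD)
  qed
  have "inj s"
  proof (rule injI, rule ext)
    fix x y k
    assume "s x = s y"
    \<comment> \<open>the node at depth \<open>k + 1\<close> is the first one to contain the bit number \<open>k\<close>\<close>
    moreover obtain p where "to_nat_on C p = Suc k"
      using index by (metis UNIV_I bij_betw_imp_surj_on imageE)
    ultimately have "node x (Suc k) = node y (Suc k)"
      using code(1) by (metis s_def injD)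
    then show "x k = y k"
      using node_eq by blast
  qed
  then have "uncountable (range s)"
    using uncountable_bool_sequences countable_image_inj_on by blast
  moreover have "finite (s x ` C \<inter> s y ` C)" if neq: "s x \<noteq> s y" for x y
  proof -
    have "x \<noteq> y"
      using neq by blast
    then obtain k where k: "x k \<noteq> y k"
      by (auto simp: fun_eq_iff)
    have "s x ` C \<inter> s y ` C \<subseteq> (\<lambda>n. code (node x n)) ` {..k}"
    proof
      fix z assume "z \<in> s x ` C \<inter> s y ` C"
      then obtain p q where "z = s x p" "z = s y q"
        by blast
      then obtain n m where z: "z = code (node x n)" "z = code (node y m)"
        unfolding s_def by blast
      then have "node x n = node y m"
        using injD[OF code(1)] by simp
      then have "n \<le> k"
        using node_eq k by (meson not_le)
      then show "z \<in> (\<lambda>n. code (node x n)) ` {..k}"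
        using z by blast
    qed
    then show ?thesis
      by (rule finite_subset) simp
  qed
  moreover have "s x ` C \<subseteq> C" for x
    using code(2) by (auto simp: s_def)
  ultimately show thesis
    using inj_s by (intro that[of "range s"]) (blast | simp)+
qed

text \<open>
  Over a countable set, the previous construction applies. Over an uncountable set,
  identifying \<open>C \<times> C\<close> with a subset of \<open>C\<close> turns the slices \<open>{i} \<times> C\<close> into
  the disjoint ranges of \<open>|C|\<close> injections.
\<close>

lemma uncountable_almost_disjoint_injections:
  includes cardinal_syntax
  fixes C :: "'a set"
  assumes "infinite C"
  obtains S :: "('a \<Rightarrow> 'a) set"
  where "uncountable S" "\<And>s. s \<in> S \<Longrightarrow> inj_on s C \<and> s ` C \<subseteq> C"
    "\<And>s s'. \<lbrakk>s \<in> S; s' \<in> S; s \<noteq> s'\<rbrakk> \<Longrightarrow> finite (s ` C \<inter> s' ` C)"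
proof (cases "countable C")
  case True
  then show thesis
    using almost_disjoint_injections_countable assms that by blast
next
  case False
  have "|C \<times> C| \<le>o |C|"
    using card_of_Times_same_infinite[OF assms] ordIso_iff_ordLeq by blast
  then obtain pair where pair: "inj_on pair (C \<times> C)" "pair ` (C \<times> C) \<subseteq> C"
    by (auto simp: card_of_ordLeq[symmetric])
  define s where "s i = (\<lambda>p. pair (i, p))" for i
  obtain c where "c \<in> C"
    using assms by fastforce
  then have "inj_on s C"
    using pair(1) by (auto simp: s_def inj_on_def dest!: fun_cong[where x = c])
  then have "uncountable (s ` C)"
    using False countable_image_inj_on by blast
  moreover have "s i ` C \<inter> s j ` C = {}" if "i \<in> C" "j \<in> C" "s i \<noteq> s j" for i j
    using pair(1) that by (auto simp: s_def dest!: inj_onD)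
  ultimately show thesis
    using that[of "s ` C"] pair by (fastforce simp: s_def inj_on_def)
qed

section \<open>The action of the self-maps of the domain\<close>

definition unary_op :: "'a set \<Rightarrow> ('a \<Rightarrow> 'a) \<Rightarrow> 'a operation" where
  "unary_op C h = (1, \<lambda>xs\<in>nlists 1 C. h (xs ! 0))"

lemma unary_op_in_nary_ops: "h \<in> C \<rightarrow> C \<Longrightarrow> unary_op C h \<in> nary_ops C 1"
  by (auto simp: unary_op_def nary_ops_def nlistsE_nth_in Pi_iff)

lemma all_ops_arity_in_nary_ops:
  assumes "f \<in> all_ops D"
  shows "f \<in> nary_ops D (fst f)"
proof -
  obtain m where "f \<in> nary_ops D m"
    using assms unfolding all_ops_def by blast
  then show ?thesis
    by (simp add: nary_ops_def mem_Times_iff)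
qed

lemma proj_op_in_nary_ops: "k < n \<Longrightarrow> proj_op C n k \<in> nary_ops C n"
  by (auto simp: proj_op_def nary_ops_def nlistsE_nth_in)

lemma comp_unary_op_proj_op:
  assumes "k < n"
  shows "comp_op C n (unary_op C h) [proj_op C n k] = (n, \<lambda>xs\<in>nlists n C. h (xs ! k))"
proof -
  have "[xs ! k] \<in> nlists 1 C" if "xs \<in> nlists n C" for xs
    using nlistsE_nth_in[OF that assms] by (intro nlistsI) auto
  then show ?thesis
    by (auto simp: comp_op_def unary_op_def proj_op_def intro!: restrict_ext)
qed

lemma comp_unary_op_unary_op:
  assumes "k \<in> C \<rightarrow> C"
  shows "comp_op C 1 (unary_op C h) [unary_op C k] = unary_op C (h \<circ> k)"
proof -
  have "[k (xs ! 0)] \<in> nlists 1 C" if "xs \<in> nlists 1 C" for xs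
    using nlistsE_nth_in[OF that] assms by (intro nlistsI) auto
  then show ?thesis
    by (auto simp: comp_op_def unary_op_def intro!: restrict_ext)
qed

locale clone_hom_from_all_unary =
  fixes C :: "'a set" and \<C> :: "'a operation set"
    and D :: "'b set" and \<xi> :: "'a operation \<Rightarrow> 'b operation"
  assumes clone: "function_clone C \<C>"
    and unary: "nary_ops C 1 \<subseteq> \<C>"
    and countable_D: "countable D"
    and hom: "clone_hom C \<C> D (all_ops D) \<xi>"
begin

definition act :: "('a \<Rightarrow> 'a) \<Rightarrow> 'b \<Rightarrow> 'b" where
  "act h d = snd (\<xi> (unary_op C h)) [d]"

lemma hom_in_nary_ops:
  assumes "f \<in> \<C>" "f \<in> nary_ops C n"
  shows "\<xi> f \<in> nary_ops D n"
proof -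
  have "\<xi> f \<in> all_ops D" "fst (\<xi> f) = n"
    using assms hom by (auto simp: clone_hom_def nary_ops_def)
  then show ?thesis
    using all_ops_arity_in_nary_ops by blast
qed

lemma hom_proj_op: "k < n \<Longrightarrow> \<xi> (proj_op C n k) = proj_op D n k"
  using hom by (simp add: clone_hom_def)

lemma hom_comp_op:
  assumes "n \<ge> 1" "m \<ge> 1" "f \<in> \<C> \<inter> nary_ops C n" "gs \<in> nlists n (\<C> \<inter> nary_ops C m)"
  shows "\<xi> (comp_op C m f gs) = comp_op D m (\<xi> f) (map \<xi> gs)"
  using assms hom by (simp add: clone_hom_def)

lemma unary_op_in_clone: "h \<in> C \<rightarrow> C \<Longrightarrow> unary_op C h \<in> \<C> \<inter> nary_ops C 1"
  using unary unary_op_in_nary_ops by blast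

lemma proj_op_in_clone: "k < n \<Longrightarrow> proj_op C n k \<in> \<C> \<inter> nary_ops C n"
  using clone proj_op_in_nary_ops by (auto simp: function_clone_def)

lemma comp_op_in_clone:
  assumes "n \<ge> 1" "m \<ge> 1" "f \<in> \<C> \<inter> nary_ops C n" "gs \<in> nlists n (\<C> \<inter> nary_ops C m)"
  shows "comp_op C m f gs \<in> \<C>"
  using assms clone unfolding function_clone_def by blast

lemma act_in: "h \<in> C \<rightarrow> C \<Longrightarrow> d \<in> D \<Longrightarrow> act h d \<in> D"
  using hom_in_nary_ops[of "unary_op C h" 1] unary_op_in_clone[of h]
  by (auto simp: act_def nary_ops_def)

lemma act_id:
  assumes "d \<in> D" "\<And>x. x \<in> C \<Longrightarrow> h x = x"
  shows "act h d = d"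
proof -
  have "h (xs ! 0) = xs ! 0" if "xs \<in> nlists 1 C" for xs
    using nlistsE_nth_in[OF that, of 0] assms(2) by simp
  then have "unary_op C h = proj_op C 1 0"
    unfolding unary_op_def proj_op_def by (metis (no_types, lifting) restrict_ext)
  then have "\<xi> (unary_op C h) = proj_op D 1 0"
    using hom_proj_op[of 0 1] by simp
  then show ?thesis
    using assms(1) by (simp add: act_def proj_op_def)
qed

lemma act_comp:
  assumes "h \<in> C \<rightarrow> C" "k \<in> C \<rightarrow> C" "d \<in> D"
  shows "act (h \<circ> k) d = act h (act k d)"
proof -
  have "\<xi> (unary_op C (h \<circ> k)) = comp_op D 1 (\<xi> (unary_op C h)) [\<xi> (unary_op C k)]"
    using hom_comp_op[of 1 1 "unary_op C h" "[unary_op C k]"]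
      unary_op_in_clone[OF assms(1)] unary_op_in_clone[OF assms(2)]
    by (simp flip: comp_unary_op_unary_op[OF assms(2)])
  then show ?thesis
    using assms(3) by (simp add: act_def comp_op_def)
qed

text \<open>
  Uncountably many injections of \<open>C\<close> act on \<open>d\<close>, but the results lie in the countable set \<open>D\<close>. So
  two of them agree at \<open>d\<close>, and undoing one after having applied the other fixes \<open>d\<close>. As the two
  ranges are almost disjoint, this composition has finite range.
\<close>

lemma fixed_by_finite_range:
  assumes d: "d \<in> D"
  obtains r where "r \<in> C \<rightarrow> C" "finite (r ` C)" "act r d = d"
proof (cases "finite C")
  case True
  then show thesis
    using that[of id] d by (simp add: act_id)
next
  case False
  then obtain S :: "('a \<Rightarrow> 'a) set" where
    S: "uncountable S" "\<And>s. s \<in> S \<Longrightarrow> inj_on s C \<and> s ` C \<subseteq> C"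
      "\<And>s s'. \<lbrakk>s \<in> S; s' \<in> S; s \<noteq> s'\<rbrakk> \<Longrightarrow> finite (s ` C \<inter> s' ` C)"
    using uncountable_almost_disjoint_injections by metis
  have S_maps: "s \<in> C \<rightarrow> C" if "s \<in> S" for s
    using S(2)[OF that] by blast
  have "(\<lambda>s. act s d) ` S \<subseteq> D"
    using S_maps act_in d by blast
  then have "\<not> inj_on (\<lambda>s. act s d) S"
    using S(1) countable_D countable_image_inj_on countable_subset by blast
  then obtain s s' where s: "s \<in> S" "s' \<in> S" "s \<noteq> s'" "act s d = act s' d"
    by (auto simp: inj_on_def)
  obtain c where c: "c \<in> C"
    using False by fastforce
  \<comment> \<open>outside the range of \<open>s\<close> the left inverse is constant, to keep the range of \<open>t \<circ> s'\<close> finite\<close>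
  define t where "t y = (if y \<in> s ` C then inv_into C s y else c)" for y
  have t: "t \<in> C \<rightarrow> C"
    using c by (auto simp: t_def inv_into_into)
  have t_s: "(t \<circ> s) x = x" if "x \<in> C" for x
    using that s(1) S(2) by (simp add: t_def)
  show thesis
  proof
    show "t \<circ> s' \<in> C \<rightarrow> C"
      using t S_maps[OF s(2)] by auto
    have "(t \<circ> s') ` C \<subseteq> insert c (t ` (s ` C \<inter> s' ` C))"
      by (auto simp: t_def)
    then show "finite ((t \<circ> s') ` C)"
      by (rule finite_subset) (use S(3) s in simp)
    have "act (t \<circ> s') d = act (t \<circ> s) d"
      using act_comp t S_maps s d by simp
    also have "\<dots> = d"
      using act_id d t_s by blast
    finally show "act (t \<circ> s') d = d" .
  qed
qed

section \<open>Finite determination and continuity\<close>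

text \<open>
  Each entry \<open>d\<^sub>j\<close> of \<open>ds\<close> is fixed by a self-map \<open>r\<^sub>j\<close> of finite range. Substituting \<open>r\<^sub>j(x\<^sub>j)\<close> for the
  variable \<open>x\<^sub>j\<close> of \<open>f\<close> therefore does not change the value of the image at \<open>ds\<close>, while only finitely
  many values of \<open>f\<close> survive the substitution. The set \<open>F\<close> depends on \<open>ds\<close> but not on \<open>f\<close>, so that
  evaluation at \<open>ds\<close> after \<open>\<xi>\<close> is even uniformly continuous.
\<close>

lemma finitely_determined:
  assumes n: "n \<ge> 1" and ds: "ds \<in> nlists n D"
  obtains F where "finite F" "F \<subseteq> nlists n C"
    "\<And>f g. \<lbrakk>f \<in> \<C> \<inter> nary_ops C n; g \<in> \<C> \<inter> nary_ops C n; \<And>a. a \<in> F \<Longrightarrow> snd f a = snd g a\<rbrakk>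
      \<Longrightarrow> snd (\<xi> f) ds = snd (\<xi> g) ds"
proof -
  have "\<exists>r. r \<in> C \<rightarrow> C \<and> finite (r ` C) \<and> act r (ds ! j) = ds ! j" if "j < n" for j
    using fixed_by_finite_range nlistsE_nth_in[OF ds that] by metis
  then obtain r where r: "\<And>j. j < n \<Longrightarrow> r j \<in> C \<rightarrow> C" "\<And>j. j < n \<Longrightarrow> finite (r j ` C)"
      "\<And>j. j < n \<Longrightarrow> act (r j) (ds ! j) = ds ! j"
    by metis
  define R where "R j = comp_op C n (unary_op C (r j)) [proj_op C n j]" for j
  have R_eq: "R j = (n, \<lambda>xs\<in>nlists n C. r j (xs ! j))" if "j < n" for j
    using that by (simp add: R_def comp_unary_op_proj_op)
  have R_in: "R j \<in> \<C> \<inter> nary_ops C n" if "j < n" for j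
  proof -
    have "R j \<in> \<C>"
      unfolding R_def
      by (rule comp_op_in_clone[of 1])
        (use n unary_op_in_clone[OF r(1)[OF that]] proj_op_in_clone[OF that] in simp_all)
    moreover have "r j (xs ! j) \<in> C" if xs: "xs \<in> nlists n C" for xs
      using r(1)[OF \<open>j < n\<close>] nlistsE_nth_in[OF xs \<open>j < n\<close>] by blast
    then have "R j \<in> nary_ops C n"
      using that by (simp add: R_eq nary_ops_def)
    ultimately show ?thesis
      by blast
  qed
  have R_fix: "snd (\<xi> (R j)) ds = ds ! j" if "j < n" for j
  proof -
    have "\<xi> (R j) = comp_op D n (\<xi> (unary_op C (r j))) [proj_op D n j]"
      using hom_comp_op[of 1 n "unary_op C (r j)" "[proj_op C n j]"] n
        unary_op_in_clone[OF r(1)[OF that]] proj_op_in_clone[OF that] hom_proj_op[OF that]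
      by (simp add: R_def)
    then show ?thesis
      using r(3)[OF that] ds by (simp add: comp_op_def proj_op_def act_def)
  qed
  let ?Rs = "map R [0..<n]"
  have value_eq: "snd (\<xi> (comp_op C n f ?Rs)) ds = snd (\<xi> f) ds"
    if "f \<in> \<C> \<inter> nary_ops C n" for f
  proof -
    have "?Rs \<in> nlists n (\<C> \<inter> nary_ops C n)"
      using R_in by (auto intro!: nlistsI)
    then have "\<xi> (comp_op C n f ?Rs) = comp_op D n (\<xi> f) (map \<xi> ?Rs)"
      using hom_comp_op n that by blast
    moreover have "map (\<lambda>g. snd g ds) (map \<xi> ?Rs) = ds"
      by (rule nth_equalityI) (use R_fix nlistsE_length[OF ds] in simp_all)
    ultimately show ?thesis
      using ds by (simp only: comp_op_def snd_conv restrict_apply if_True)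
  qed
  \<comment> \<open>one common finite alphabet replaces the product of the ranges of the \<open>r j\<close>\<close>
  define B where "B = (\<Union>j<n. r j ` C)"
  have B: "finite B" "B \<subseteq> C"
    using r(1,2) by (auto simp: B_def)
  show thesis
  proof
    show "finite (nlists n B)"
      by (rule finite_subset[OF _ finite_lists_length_eq[OF B(1), of n]])
        (auto dest: nlistsE_set)
    show "nlists n B \<subseteq> nlists n C"
      using B(2) unfolding nlists_def by blast
    fix f g
    assume fg: "f \<in> \<C> \<inter> nary_ops C n" "g \<in> \<C> \<inter> nary_ops C n"
      and agree: "\<And>a. a \<in> nlists n B \<Longrightarrow> snd f a = snd g a"
    have "map (\<lambda>h. snd h xs) ?Rs \<in> nlists n B" if "xs \<in> nlists n C" for xs
    proof (rule nlistsI)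
      have "r j (xs ! j) \<in> B" if "j < n" for j
        using nlistsE_nth_in[OF \<open>xs \<in> nlists n C\<close> that] that by (auto simp: B_def)
      then show "set (map (\<lambda>h. snd h xs) ?Rs) \<subseteq> B"
        using that by (auto simp: R_eq)
    qed simp
    then have "comp_op C n f ?Rs = comp_op C n g ?Rs"
      unfolding comp_op_def using agree by (metis (no_types, lifting) restrict_ext)
    then show "snd (\<xi> f) ds = snd (\<xi> g) ds"
      using value_eq fg by metis
  qed
qed

lemma openin_agreement_set:
  assumes "n \<ge> 1" "finite F" "F \<subseteq> nlists n C" "f \<in> nary_ops C n"
  shows "openin (clone_topology C \<C>) {g \<in> \<C> \<inter> nary_ops C n. \<forall>a\<in>F. snd g a = snd f a}"
proof -
  let ?U = "nary_ops C n \<inter> (\<Inter>a\<in>F. {p \<in> nary_ops C n. snd p a = snd f a})"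
  have value_open: "openin (pointwise_topology C) {p \<in> nary_ops C n. snd p a = snd f a}"
    if "a \<in> F" for a
  proof (rule openin_pointwise_eq)
    show a: "a \<in> nlists n C"
      using assms(3) that by blast
    show "snd f a \<in> C"
      using assms(4) a by (auto simp: nary_ops_def)
  qed (fact assms(1))
  have "openin (pointwise_topology C) ?U"
  proof (cases "F = {}")
    case True
    then show ?thesis
      using openin_nary_ops[OF assms(1)] by simp
  next
    case False
    then have "openin (pointwise_topology C) (\<Inter>a\<in>F. {p \<in> nary_ops C n. snd p a = snd f a})"
      using assms(2) value_open by (intro openin_Inter) auto
    then show ?thesis
      using openin_nary_ops[OF assms(1)] by (intro openin_Int)
  qed
  then have "openin (clone_topology C \<C>) (\<C> \<inter> ?U)"
    unfolding clone_topology_def by (rule openin_subtopology_Int2)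
  moreover have "\<C> \<inter> ?U = {g \<in> \<C> \<inter> nary_ops C n. \<forall>a\<in>F. snd g a = snd f a}"
    by blast
  ultimately show ?thesis
    by simp
qed

lemma topspace_clone: "topspace (clone_topology C \<C>) = \<C>"
  using clone by (auto simp: clone_topology_def topspace_pointwise_topology function_clone_def)

lemma continuous: "continuous_map (clone_topology C \<C>) (clone_topology D (all_ops D)) \<xi>"
proof -
  have maps: "\<xi> ` \<C> \<subseteq> all_ops D"
    using hom by (simp add: clone_hom_def)
  have arity: "f \<in> nary_ops C n" if "f \<in> \<C>" "\<xi> f \<in> nary_ops D n" for f n
  proof -
    have "f \<in> all_ops C" "fst f = n"
      using clone hom that by (auto simp: function_clone_def clone_hom_def nary_ops_def)
    then show ?thesis
      using all_ops_arity_in_nary_ops by blast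
  qed
  have arity_open: "openin (clone_topology C \<C>) (\<xi> -` nary_ops D n \<inter> \<C>)" if "n \<ge> 1" for n
  proof -
    have "\<xi> -` nary_ops D n \<inter> \<C> = \<C> \<inter> nary_ops C n"
      by (intro equalityI subsetI) (use arity in blast, use hom_in_nary_ops in blast)
    then show ?thesis
      using openin_subtopology_Int2[OF openin_nary_ops[OF that]]
      by (simp add: clone_topology_def)
  qed
  have value_open: "openin (clone_topology C \<C>) (\<xi> -` {p \<in> nary_ops D n. snd p ds = d} \<inter> \<C>)"
    (is "openin _ ?V") if n: "n \<ge> 1" and ds: "ds \<in> nlists n D" for n ds d
  proof (subst openin_subopen, rule ballI)
    obtain F where F: "finite F" "F \<subseteq> nlists n C"
      "\<And>f g. \<lbrakk>f \<in> \<C> \<inter> nary_ops C n; g \<in> \<C> \<inter> nary_ops C n; \<And>a. a \<in> F \<Longrightarrow> snd f a = snd g a\<rbrakk>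
        \<Longrightarrow> snd (\<xi> f) ds = snd (\<xi> g) ds"
      using finitely_determined[OF n ds] by metis
    fix f assume f: "f \<in> ?V"
    let ?A = "{g \<in> \<C> \<inter> nary_ops C n. \<forall>a\<in>F. snd g a = snd f a}"
    have f_in: "f \<in> \<C> \<inter> nary_ops C n"
      using f arity by blast
    have "?A \<subseteq> ?V"
    proof
      fix g assume g: "g \<in> ?A"
      then have "snd (\<xi> g) ds = snd (\<xi> f) ds"
        using F(3) f_in by blast
      then show "g \<in> ?V"
        using f g hom_in_nary_ops by auto
    qed
    moreover have "openin (clone_topology C \<C>) ?A"
      using openin_agreement_set n F(1,2) f_in by blast
    ultimately show "\<exists>T. openin (clone_topology C \<C>) T \<and> f \<in> T \<and> T \<subseteq> ?V"
      using f_in by blast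
  qed
  let ?subbasis = "{nary_ops D n | n. n \<ge> 1} \<union>
    {{p \<in> nary_ops D n. snd p a = a0} | n a a0. n \<ge> 1 \<and> a \<in> nlists n D \<and> a0 \<in> D}"
  have "continuous_map (clone_topology C \<C>) (pointwise_topology D) \<xi>"
    unfolding pointwise_topology_def
  proof (rule continuous_on_generated_topo)
    fix U assume "U \<in> ?subbasis"
    then consider n where "n \<ge> 1" "U = nary_ops D n"
      | n a a0 where "n \<ge> 1" "a \<in> nlists n D" "U = {p \<in> nary_ops D n. snd p a = a0}"
      by blast
    then show "openin (clone_topology C \<C>) (\<xi> -` U \<inter> topspace (clone_topology C \<C>))"
    proof cases
      case 1
      then show ?thesis
        unfolding topspace_clone 1(2) by (intro arity_open)
    next
      case 2
      then show ?thesis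
        unfolding topspace_clone 2(3) by (intro value_open)
    qed
  next
    have "all_ops D = \<Union> ?subbasis"
      using topspace_pointwise_topology
      unfolding pointwise_topology_def topology_generated_by_topspace by (rule sym)
    then show "\<xi> ` topspace (clone_topology C \<C>) \<subseteq> \<Union> ?subbasis"
      using maps unfolding topspace_clone by (simp only:)
  qed
  then show ?thesis
    unfolding clone_topology_def[of D] continuous_map_in_subtopology topspace_clone
    using maps image_subset_iff_funcset by blast
qed

end

theorem theorem25:
  fixes C :: "'a set" and \<C> :: "'a operation set"
    and D :: "'b set" and \<xi> :: "'a operation \<Rightarrow> 'b operation"
  assumes "function_clone C \<C>"
    and "nary_ops C 1 \<subseteq> \<C>"
    and "countable D" and "infinite D"
    and "clone_hom C \<C> D (all_ops D) \<xi>"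
  shows "continuous_map (clone_topology C \<C>) (clone_topology D (all_ops D)) \<xi>"
proof -
  interpret clone_hom_from_all_unary C \<C> D \<xi>
    by unfold_locales (fact assms)+
  show ?thesis
    by (rule continuous)
qed

end
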